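(* Let $T_{k,j}$ ($k\ge1$, $1\le j\le n_k$) be real $d\times d$ matrices satisfying the standing assumption $0<\alpha_-\le\alpha_+<1$ (see context). Let $$s^*=\inf\Big\{s>0:\limsup_{\epsilon\to0}\sum_{\mathbf u\in\Sigma^*(s,\epsilon)}\phi^s(T_{\mathbf u})<\infty\Big\},\qquad s_A=\inf\{s\ge0:\mathcal{M}^s(\Sigma^\infty)=0\}.$$ Then $$s_A\le s^*.$$
   Context: Let $\{n_k\}_{k\ge1}$ be integers with $n_k\ge2$. Put $\Sigma^k=\{u_1\cdots u_k:1\le u_j\le n_j\}$, $\Sigma^0=\{\emptyset\}$, $\Sigma^*=\bigcup_{k\ge0}\Sigma^k$, and $\Sigma^\infty=\{u_1u_2\cdots:1\le u_k\le n_k\}$. For $\mathbf u\in\Sigma^*$, $\mathcal{C}_{\mathbf u}\subset\Sigma^\infty$ is the cylinder of infinite words beginning with $\mathbf u$, and $|\mathbf u|$ is the length of $\mathbf u$. For $\mathbf u=u_1\cdots u_k$ write $T_{\mathbf u}=T_{1,u_1}\cdots T_{k,u_k}$ and $\mathbf u^-=u_1\cdots u_{k-1}$ ($T_\emptyset$ is the identity). Singular values of a matrix $T$ are $\alpha_1(T)\ge\dots\ge\alpha_d(T)$. Standing assumption: all $T_{k,i}$ are nonsingular and $0<\alpha_-\le\alpha_+<1$, where $\alpha_+=\sup_{k,i}\alpha_1(T_{k,i})$, $\alpha_-=\inf_{k,i}\alpha_d(T_{k,i})$. Singular value function: for $0<s\le d$, $\phi^s(T)=\alpha_1(T)\cdots\alpha_{m-1}(T)\alpha_m(T)^{s-m+1}$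 with $m$ the integer such that $m-1<s\le m$; $\phi^0(T)=1$; for $s>d$, $\phi^s(T)=(\alpha_1(T)\cdots\alpha_d(T))^{s/d}$. For $s>0$, $0<\epsilon<1$ and $m$ the integer with $m-1<s\le m$, $\Sigma^*(s,\epsilon)=\{\mathbf u\in\Sigma^*\setminus\{\emptyset\}:\alpha_m(T_{\mathbf u})\le\epsilon<\alpha_m(T_{\mathbf u^-})\}$, with the convention $\alpha_m=\alpha_d$ when $m>d$. For $s\ge0$, $G\subset\Sigma^\infty$ and $k\ge1$, $\mathcal{M}^s_{(k)}(G)=\inf\{\sum_{\mathbf u}\phi^s(T_{\mathbf u}):G\subset\bigcup_{\mathbf u}\mathcal{C}_{\mathbf u},\ |\mathbf u|\ge k\}$ (infimum over covers of $G$ by cylinders of words of length at least $k$), and $\mathcal{M}^s(G)=\lim_{k\to\infty}\mathcal{M}^s_{(k)}(G)$. One has $s_A=\inf\{s:\mathcal{M}^s(\Sigma^\infty)=0\}=\sup\{s:\mathcal{M}^s(\Sigma^\infty)=\infty\}$. *)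

theory Defs
  imports "HOL-Analysis.Analysis" "HOL-Computational_Algebra.Computational_Algebra"
begin

definition charpoly :: "real^'d^'d \<Rightarrow> real poly" where
  "charpoly A = det (mat [:0, 1:] - (\<chi> i j. [:A $ i $ j:]))"

text \<open>The characteristic polynomial of the symmetric matrix \<open>T\<^sup>t T\<close> has only real, nonnegative roots,
  so the multiset below has exactly \<open>CARD('d)\<close> elements (roots counted with multiplicity).\<close>

definition singular_values :: "real^'d^'d \<Rightarrow> real list" where
  "singular_values T =
     rev (sorted_list_of_multiset (image_mset sqrt (proots (charpoly (transpose T ** T)))))"

text \<open>The index is 1-based: \<open>sing_val 1 T \<ge> \<dots> \<ge> sing_val CARD('d) T\<close>.\<close>

definition sing_val :: "nat \<Rightarrow> real^'d^'d \<Rightarrow> real" where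
  "sing_val i T = singular_values T ! (i - 1)"

text \<open>For \<open>s > 0\<close>, \<open>nat \<lceil>s\<rceil>\<close> is the integer \<open>m\<close> with \<open>m - 1 < s \<le> m\<close>.
  The definition is only meaningful for \<open>s \<ge> 0\<close>.\<close>

definition svf :: "real \<Rightarrow> real^'d^'d \<Rightarrow> real" where
  "svf s T =
     (if s = 0 then 1
      else if s \<le> real CARD('d) then
        (let m = nat \<lceil>s\<rceil> in (\<Prod>i=1..<m. sing_val i T) * sing_val m T powr (s - real m + 1))
      else (\<Prod>i=1..CARD('d). sing_val i T) powr (s / real CARD('d)))"

text \<open>Alphabet sizes \<open>n k\<close> and matrices \<open>T k i\<close> are used for \<open>k \<ge> 1\<close> and \<open>1 \<le> i \<le> n k\<close> only.
  Lists and sequences are 0-based, so entry \<open>j\<close> of a word is its letter number \<open>Suc j\<close>.\<close>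

definition words :: "(nat \<Rightarrow> nat) \<Rightarrow> nat list set" where
  "words n = {u. \<forall>j<length u. u ! j \<in> {1..n (Suc j)}}"

definition infinite_words :: "(nat \<Rightarrow> nat) \<Rightarrow> (nat \<Rightarrow> nat) set" where
  "infinite_words n = {w. \<forall>j. w j \<in> {1..n (Suc j)}}"

definition cylinder :: "(nat \<Rightarrow> nat) \<Rightarrow> nat list \<Rightarrow> (nat \<Rightarrow> nat) set" where
  "cylinder n u = {w \<in> infinite_words n. \<forall>j<length u. w j = u ! j}"

definition word_mat :: "(nat \<Rightarrow> nat \<Rightarrow> real^'d^'d) \<Rightarrow> nat list \<Rightarrow> real^'d^'d" where
  "word_mat T u = foldr (**) (map (\<lambda>j. T (Suc j) (u ! j)) [0..<length u]) (mat 1)"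

text \<open>Supremum and infimum are taken in the extended reals, so that an unbounded family
  has \<open>alpha_plus = \<infinity>\<close>.\<close>

definition alpha_plus :: "(nat \<Rightarrow> nat) \<Rightarrow> (nat \<Rightarrow> nat \<Rightarrow> real^'d^'d) \<Rightarrow> ereal" where
  "alpha_plus n T = (SUP (k, i) \<in> (SIGMA k:{1..}. {1..n k}). ereal (sing_val 1 (T k i)))"

definition alpha_minus :: "(nat \<Rightarrow> nat) \<Rightarrow> (nat \<Rightarrow> nat \<Rightarrow> real^'d^'d) \<Rightarrow> ereal" where
  "alpha_minus n T = (INF (k, i) \<in> (SIGMA k:{1..}. {1..n k}). ereal (sing_val CARD('d) (T k i)))"

definition stopping_words ::
    "(nat \<Rightarrow> nat) \<Rightarrow> (nat \<Rightarrow> nat \<Rightarrow> real^'d^'d) \<Rightarrow> real \<Rightarrow> real \<Rightarrow> nat list set" where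
  "stopping_words n T s \<epsilon> =
     (let m = min (nat \<lceil>s\<rceil>) CARD('d)
      in {u \<in> words n. u \<noteq> [] \<and> sing_val m (word_mat T u) \<le> \<epsilon> \<and>
                       \<epsilon> < sing_val m (word_mat T (butlast u))})"

definition net_measure_at ::
    "(nat \<Rightarrow> nat) \<Rightarrow> (nat \<Rightarrow> nat \<Rightarrow> real^'d^'d) \<Rightarrow> real \<Rightarrow> nat \<Rightarrow> (nat \<Rightarrow> nat) set \<Rightarrow> ennreal" where
  "net_measure_at n T s k G =
     (INF U \<in> {U. U \<subseteq> words n \<and> (\<forall>u\<in>U. k \<le> length u) \<and> G \<subseteq> (\<Union>u\<in>U. cylinder n u)}.
        \<Sum>\<^sub>\<infinity>u\<in>U. ennreal (svf s (word_mat T u)))"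

definition net_measure ::
    "(nat \<Rightarrow> nat) \<Rightarrow> (nat \<Rightarrow> nat \<Rightarrow> real^'d^'d) \<Rightarrow> real \<Rightarrow> (nat \<Rightarrow> nat) set \<Rightarrow> ennreal" where
  "net_measure n T s G = lim (\<lambda>k. net_measure_at n T s k G)"

text \<open>Both exponents are extended reals: the infimum of the empty set is \<open>\<infinity>\<close>, which does occur
  since \<open>n\<close> need not be bounded.\<close>

definition s_star :: "(nat \<Rightarrow> nat) \<Rightarrow> (nat \<Rightarrow> nat \<Rightarrow> real^'d^'d) \<Rightarrow> ereal" where
  "s_star n T = Inf (ereal ` {s. 0 < s \<and>
     Limsup (at_right 0) (\<lambda>\<epsilon>. \<Sum>\<^sub>\<infinity>u\<in>stopping_words n T s \<epsilon>. ennreal (svf s (word_mat T u))) < \<infinity>})"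

definition s_A :: "(nat \<Rightarrow> nat) \<Rightarrow> (nat \<Rightarrow> nat \<Rightarrow> real^'d^'d) \<Rightarrow> ereal" where
  "s_A n T = Inf (ereal ` {s. 0 \<le> s \<and> net_measure n T s (infinite_words n) = 0})"

end

theory Submission
  imports Defs
begin

text \<open>Let \<open>0 < s < t\<close> with the upper limit defining \<open>s\<^sup>*\<close> finite at \<open>s\<close>. Since \<open>\<alpha>\<^sub>m(T\<^sub>u)\<close>
  lies between \<open>\<alpha>\<^sub>-\<close> and \<open>\<alpha>\<^sub>+\<close> raised to the power \<open>|u|\<close>, the cylinders of the stopping words at
  scale \<open>\<epsilon>\<close> cover the sequence space, and their lengths are at least \<open>K\<close> as soon as
  \<open>\<epsilon> < \<alpha>\<^sub>-\<^sup>K\<close>. For such words \<open>\<phi>\<^sup>t\<close> is at most \<open>\<phi>\<^sup>s\<close> times the \<open>K\<close>-th power of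
  \<open>\<alpha>\<^sub>+\<close> raised to \<open>t - s\<close>, so the net measure at exponent \<open>t\<close> vanishes and
  \<open>s\<^sub>A \<le> t\<close>.

  Only the two extreme singular values are identified with norms. The Gram matrix \<open>T\<^sup>t T\<close> has only
  real characteristic roots, each with a real eigenvector, so every singular value is
  a ratio \<open>|T v| / |v|\<close>; conversely an extremiser of this ratio is an eigenvector.\<close>

section \<open>Singular values as roots of the characteristic polynomial\<close>

text \<open>The Leibniz formula uses only sums, products and signs, all of which \<open>h\<close>
  preserves. It is applied below to the evaluation of polynomial entries at a real or complex
  point.\<close>

lemma det_ring_hom:
  fixes h :: "'a::comm_ring_1 \<Rightarrow> 'b::comm_ring_1" and M :: "'a^'d^'d"
  assumes one: "h 1 = 1" and add: "\<And>x y. h (x + y) = h x + h y"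
    and mult: "\<And>x y. h (x * y) = h x * h y"
  shows "h (det M) = det (\<chi> i j. h (M $ i $ j))"
proof -
  have zero: "h 0 = 0"
    using add[of 0 0] by simp
  have uminus: "h (- x) = - h x" for x
    using add[of x "- x"] zero by (simp add: eq_neg_iff_add_eq_0 add.commute)
  have sum: "h (sum f A) = (\<Sum>x\<in>A. h (f x))" for f :: "('d \<Rightarrow> 'd) \<Rightarrow> 'a" and A
    by (induction A rule: infinite_finite_induct) (auto simp: zero add)
  have prod: "h (prod f A) = (\<Prod>x\<in>A. h (f x))" for f :: "'d \<Rightarrow> 'a" and A
    by (induction A rule: infinite_finite_induct) (auto simp: one mult)
  have sign: "h (of_int (sign p)) = of_int (sign p)" for p :: "'d \<Rightarrow> 'd"
    by (simp add: sign_def one uminus)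
  show ?thesis
    unfolding det_def by (simp add: sum prod mult sign)
qed

lemma det_zero_iff_kernel:
  fixes M :: "'a::field^'d^'d"
  shows "det M = 0 \<longleftrightarrow> (\<exists>v. v \<noteq> 0 \<and> M *v v = 0)"
  using invertible_det_nz[of M] invertible_left_inverse[of M] matrix_left_invertible_ker[of M]
  by auto

lemma mat_mult_vec: "mat c *v v = c *s (v :: 'a::comm_ring_1^'d)"
  by (vector matrix_vector_mult_def mat_def)
    (simp add: if_distrib if_distribR cong del: if_weak_cong)

lemma poly_charpoly: "poly (charpoly A) x = det (mat x - A)"
proof -
  have "poly (charpoly A) x
      = det (\<chi> i j. poly ((mat [:0, 1:] - (\<chi> i j. [:A $ i $ j:])) $ i $ j) x)"
    unfolding charpoly_def by (rule det_ring_hom) auto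
  also have "(\<chi> i j. poly ((mat [:0, 1:] - (\<chi> i j. [:A $ i $ j:])) $ i $ j) x) = mat x - A"
    by (auto simp: vec_eq_iff mat_def)
  finally show ?thesis .
qed

text \<open>Complex points enter because counting the roots rests on the algebraic closedness of the
  complex numbers.\<close>

definition cpoly :: "real poly \<Rightarrow> complex \<Rightarrow> complex" where
  "cpoly p z = poly (map_poly of_real p) z"

lemma cpoly_pCons: "cpoly (pCons a p) z = of_real a + z * cpoly p z"
  by (simp add: cpoly_def map_poly_pCons)

lemma cpoly_0: "cpoly 0 z = 0"
  by (simp add: cpoly_def)

lemma cpoly_add: "cpoly (p + q) z = cpoly p z + cpoly q z"
  by (induction p q rule: poly_induct2) (simp_all add: cpoly_0 cpoly_pCons algebra_simps)

lemma cpoly_smult: "cpoly (smult a p) z = of_real a * cpoly p z"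
  by (induction p) (simp_all add: cpoly_0 cpoly_pCons algebra_simps)

lemma cpoly_mult: "cpoly (p * q) z = cpoly p z * cpoly q z"
  by (induction p) (simp_all add: cpoly_0 cpoly_pCons cpoly_add cpoly_smult algebra_simps)

lemma cpoly_of_real: "cpoly p (of_real x) = of_real (poly p x)"
  by (induction p) (simp_all add: cpoly_0 cpoly_pCons)

lemma cpoly_charpoly: "cpoly (charpoly A) z = det (mat z - (\<chi> i j. of_real (A $ i $ j)))"
proof -
  have "cpoly (charpoly A) z
      = det (\<chi> i j. cpoly ((mat [:0, 1:] - (\<chi> i j. [:A $ i $ j:])) $ i $ j) z)"
    unfolding charpoly_def
    by (rule det_ring_hom) (auto simp: cpoly_add cpoly_mult, simp add: cpoly_def)
  also have "(\<chi> i j. cpoly ((mat [:0, 1:] - (\<chi> i j. [:A $ i $ j:])) $ i $ j) z)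
      = mat z - (\<chi> i j. of_real (A $ i $ j))"
    by (auto simp: vec_eq_iff mat_def cpoly_pCons cpoly_0)
  finally show ?thesis .
qed

text \<open>Linear factors are split off one by one: a complex root exists, it is real by
  hypothesis, and the quotient inherits the hypothesis because its roots are roots of
  \<open>p\<close>.\<close>

lemma size_proots_real_rooted:
  assumes "p \<noteq> 0" and "\<And>z. cpoly p z = 0 \<Longrightarrow> z \<in> \<real>"
  shows "size (proots p) = degree p"
  using assms
proof (induction "degree p" arbitrary: p)
  case 0
  then obtain c where "p = [:c:]"
    by (metis degree_eq_zeroE)
  then show ?case
    by simp
next
  case (Suc k)
  have "degree (map_poly complex_of_real p) \<noteq> 0"
    using Suc.hyps(2) by (simp add: degree_map_poly)
  then obtain z where z: "cpoly p z = 0"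
    unfolding cpoly_def
    using alg_closed_imp_poly_has_root[of "map_poly complex_of_real p"] by auto
  with Suc.prems(2) obtain x where x: "z = of_real x"
    by (auto elim: Reals_cases)
  with z have "poly p x = 0"
    by (simp add: cpoly_of_real)
  then obtain q where q: "p = [:-x, 1:] * q"
    by (auto simp: poly_eq_0_iff_dvd)
  have nz: "q \<noteq> 0" "[:-x, 1:] \<noteq> 0"
    using q Suc.prems by auto
  have deg: "degree p = Suc (degree q)"
    unfolding q using nz by (subst degree_mult_eq) auto
  have "size (proots q) = degree q"
    using Suc.hyps(2) deg nz Suc.prems(2) by (intro Suc.hyps(1)) (auto simp: q cpoly_mult simp del: mult_pCons_left)
  moreover have "proots p = {#x#} + proots q"
    unfolding q proots_mult[OF nz(2,1)] by simp
  ultimately show ?case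
    using deg by simp
qed

text \<open>Only the identity permutation picks up all diagonal entries, which have degree 1. Any
  other permutation meets a constant entry, so its term has smaller degree and cannot cancel the
  leading one.\<close>

lemma degree_charpoly: "degree (charpoly (A :: real^'d^'d)) = CARD('d)"
proof -
  define M :: "real poly^'d^'d" where "M = mat [:0, 1:] - (\<chi> i j. [:A $ i $ j:])"
  define f where "f p = of_int (sign p) * (\<Prod>i\<in>UNIV. M $ i $ p i)" for p :: "'d \<Rightarrow> 'd"
  have M: "M $ i $ j = (if i = j then [:- A $ i $ j, 1:] else [:- A $ i $ j:])" for i j
    by (simp add: M_def mat_def)
  have deg_id: "degree (f id) = CARD('d)"
    unfolding f_def by (simp add: M degree_prod_sum_eq)
  have deg: "degree (f p) < CARD('d)" if "p \<noteq> id" for p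
  proof -
    obtain i where i: "p i \<noteq> i"
      using \<open>p \<noteq> id\<close> unfolding fun_eq_iff id_apply by blast
    have "degree (f p) \<le> degree (\<Prod>i\<in>UNIV. M $ i $ p i)"
      unfolding f_def by (auto simp: sign_def)
    also have "\<dots> \<le> (\<Sum>i\<in>UNIV. degree (M $ i $ p i))"
      using degree_prod_sum_le[of UNIV "\<lambda>i. M $ i $ p i"] by (simp add: o_def)
    also have "\<dots> < (\<Sum>i\<in>(UNIV :: 'd set). 1)"
      using i by (intro sum_strict_mono_ex1) (auto simp: M intro!: exI[of _ i])
    finally show ?thesis
      by simp
  qed
  have perms: "{p. p permutes (UNIV :: 'd set)} = insert id ({p. p permutes UNIV} - {id})"
    by (auto simp: permutes_id)
  have "charpoly A = (\<Sum>p | p permutes UNIV. f p)"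
    by (simp add: charpoly_def det_def f_def M_def)
  also have "\<dots> = f id + (\<Sum>p\<in>{p. p permutes UNIV} - {id}. f p)"
    by (subst perms, subst sum.insert) (auto simp: finite_permutations)
  also have "degree \<dots> = CARD('d)"
    using deg_id deg
    by (subst degree_add_eq_left) (auto intro!: degree_sum_less)
  finally show ?thesis .
qed

lemma transpose_mult_self_inner:
  fixes T :: "real^'d^'d"
  shows "x \<bullet> ((transpose T ** T) *v y) = (T *v x) \<bullet> (T *v y)"
  by (metis dot_lmul_matrix inner_commute matrix_vector_mul_assoc vector_transpose_matrix)

text \<open>A complex eigenvector is split into real and imaginary parts \<open>p\<close> and
  \<open>q\<close>. Symmetry of the Gram matrix then forces the imaginary part of \<open>z\<close>,
  times |p|^2 + |q|^2, to vanish.\<close>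

lemma charpoly_gram_root_real:
  fixes T :: "real^'d^'d"
  assumes "cpoly (charpoly (transpose T ** T)) z = 0"
  shows "z \<in> \<real>"
proof -
  define A where "A = transpose T ** T"
  obtain v where v: "v \<noteq> 0" "(mat z - (\<chi> i j. of_real (A $ i $ j))) *v v = 0"
    using assms unfolding cpoly_charpoly A_def[symmetric] det_zero_iff_kernel by auto
  define p q where "p = (\<chi> i. Re (v $ i))" and "q = (\<chi> i. Im (v $ i))"
  have eq: "(\<Sum>j\<in>UNIV. of_real (A $ i $ j) * v $ j) = z * v $ i" for i
  proof -
    have "mat z *v v = (\<chi> i j. of_real (A $ i $ j)) *v v"
      using v(2) by (simp add: matrix_vector_mult_diff_rdistrib)
    then have "(z *s v) $ i = ((\<chi> i j. of_real (A $ i $ j)) *v v) $ i"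
      by (simp only: mat_mult_vec)
    then show ?thesis
      by (simp add: matrix_vector_mult_def)
  qed
  have Ap: "A *v p = Re z *\<^sub>R p - Im z *\<^sub>R q"
    using eq[THEN arg_cong[where f = Re]]
    by (simp add: vec_eq_iff matrix_vector_mult_def p_def q_def)
  have Aq: "A *v q = Re z *\<^sub>R q + Im z *\<^sub>R p"
    using eq[THEN arg_cong[where f = Im]]
    by (simp add: vec_eq_iff matrix_vector_mult_def p_def q_def)
  have "p \<bullet> (A *v q) = q \<bullet> (A *v p)"
    by (simp add: A_def transpose_mult_self_inner inner_commute)
  then have "Im z * (p \<bullet> p + q \<bullet> q) = 0"
    unfolding Ap Aq by (simp add: algebra_simps inner_commute)
  moreover have "p \<bullet> p + q \<bullet> q \<noteq> 0"
  proof
    assume "p \<bullet> p + q \<bullet> q = 0"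
    then have "p = 0" "q = 0"
      by (simp_all add: add_nonneg_eq_0_iff)
    then show False
      using v(1) by (simp add: vec_eq_iff p_def q_def complex_eq_iff)
  qed
  ultimately show ?thesis
    by (simp add: complex_is_Real_iff)
qed

lemma charpoly_gram_root_iff:
  fixes T :: "real^'d^'d"
  shows "poly (charpoly (transpose T ** T)) x = 0
    \<longleftrightarrow> (\<exists>v. v \<noteq> 0 \<and> (transpose T ** T) *v v = x *\<^sub>R v)"
  by (auto simp: poly_charpoly det_zero_iff_kernel matrix_vector_mult_diff_rdistrib mat_mult_vec
      scalar_mult_eq_scaleR)

section \<open>Extremisers of quadratic forms and norm ratios\<close>

text \<open>Moving from \<open>v\<close> in the direction of -\<open>f v\<close> changes the form to
  first order by -2|f v|^2, so the form would become negative for a small step unless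
  \<open>f v = 0\<close>.\<close>

lemma psd_kernel:
  fixes f :: "'v::real_inner \<Rightarrow> 'v"
  assumes lin: "linear f" and sym: "\<And>x y. x \<bullet> f y = f x \<bullet> y"
    and psd: "\<And>x. 0 \<le> x \<bullet> f x" and v: "v \<bullet> f v = 0"
  shows "f v = 0"
proof (rule ccontr)
  assume nz: "f v \<noteq> 0"
  define a b where "a = f v \<bullet> f v" and "b = f v \<bullet> f (f v)"
  have a: "a > 0"
    using nz by (simp add: a_def)
  have b: "b \<ge> 0"
    using psd by (simp add: b_def)
  have quad: "0 \<le> - 2 * t * a + t\<^sup>2 * b" for t
  proof -
    have "0 \<le> (v - t *\<^sub>R f v) \<bullet> f (v - t *\<^sub>R f v)"
      by (rule psd)
    also have "\<dots> = - 2 * t * a + t\<^sup>2 * b"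
      using v sym[of v "f v"]
      by (simp add: linear_diff[OF lin] linear_scale[OF lin] a_def b_def inner_diff_left
          inner_diff_right power2_eq_square algebra_simps)
    finally show ?thesis .
  qed
  \<comment> \<open>The step must satisfy \<open>t * b < 2 * a\<close>; the summand 1 keeps the
    denominator positive when \<open>b = 0\<close>.\<close>
  define t where "t = a / (b + 1)"
  have "t > 0" "t * b < a * 2"
    using a b by (auto simp: t_def field_simps add_pos_nonneg add_nonneg_pos)
  then have "t * (- 2 * a + t * b) < 0"
    by (intro mult_pos_neg) auto
  with quad[of t] show False
    by (simp add: algebra_simps power2_eq_square)
qed

text \<open>One of \<open>c - f\<close> and \<open>f - c\<close> is positive semidefinite and its
  form vanishes at \<open>v\<close>, so \<open>psd_kernel\<close> applies. The two alternatives
  serve the largest and the smallest singular value.\<close>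

lemma extremal_quadratic_form_eigenvector:
  fixes f :: "'v::real_inner \<Rightarrow> 'v"
  assumes lin: "linear f" and sym: "\<And>x y. x \<bullet> f y = f x \<bullet> y"
    and v: "v \<bullet> f v = c * (v \<bullet> v)"
    and bnd: "(\<forall>x. x \<bullet> f x \<le> c * (x \<bullet> x)) \<or> (\<forall>x. c * (x \<bullet> x) \<le> x \<bullet> f x)"
  shows "f v = c *\<^sub>R v"
  using bnd
proof
  assume *: "\<forall>x. x \<bullet> f x \<le> c * (x \<bullet> x)"
  have "c *\<^sub>R v - f v = 0"
    by (rule psd_kernel[of "\<lambda>x. c *\<^sub>R x - f x"])
      (use * v lin sym in \<open>auto simp: inner_diff_left inner_diff_right
        intro!: linear_compose_sub linear_scaleR\<close>)
  then show ?thesis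
    by simp
next
  assume *: "\<forall>x. c * (x \<bullet> x) \<le> x \<bullet> f x"
  have "f v - c *\<^sub>R v = 0"
    by (rule psd_kernel[of "\<lambda>x. f x - c *\<^sub>R x"])
      (use * v lin sym in \<open>auto simp: inner_diff_left inner_diff_right
        intro!: linear_compose_sub linear_scaleR\<close>)
  then show ?thesis
    by simp
qed

text \<open>Compactness of the unit sphere gives both extremisers, and homogeneity extends the
  inequalities to all vectors.\<close>

lemma norm_ratio_attains:
  fixes T :: "real^'d^'d"
  obtains v w where "norm v = 1" "norm w = 1"
    "\<And>x. norm (T *v x) \<le> norm (T *v v) * norm x"
    "\<And>x. norm (T *v w) * norm x \<le> norm (T *v x)"
proof -
  have ne: "sphere (0 :: real^'d) 1 \<noteq> {}"
    by simp
  have cont: "continuous_on (sphere 0 1) (\<lambda>x. norm (T *v x))"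
    by (intro continuous_intros matrix_vector_mult_linear_continuous_on)
  obtain v where v: "v \<in> sphere 0 1"
      "\<And>x. x \<in> sphere 0 1 \<Longrightarrow> norm (T *v x) \<le> norm (T *v v)"
    using continuous_attains_sup[OF compact_sphere ne cont] by auto
  obtain w where w: "w \<in> sphere 0 1"
      "\<And>x. x \<in> sphere 0 1 \<Longrightarrow> norm (T *v w) \<le> norm (T *v x)"
    using continuous_attains_inf[OF compact_sphere ne cont] by auto
  have unit: "norm (T *v x) = norm (T *v (x /\<^sub>R norm x)) * norm x \<and> x /\<^sub>R norm x \<in> sphere 0 1"
    if "x \<noteq> 0" for x
    using that by (simp add: matrix_vector_mult_scaleR)
  show ?thesis
  proof (rule that)
    show "norm v = 1" "norm w = 1"
      using v w by auto
    show "norm (T *v x) \<le> norm (T *v v) * norm x" for x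
      using unit[of x] v(2) by (cases "x = 0") (auto intro: mult_right_mono)
    show "norm (T *v w) * norm x \<le> norm (T *v x)" for x
      using unit[of x] w(2) by (cases "x = 0") (auto intro: mult_right_mono)
  qed
qed

section \<open>Comparison of singular values with norms\<close>

text \<open>This guarantees that the list access in \<open>sing_val\<close> is in range for indices
  from 1 to the dimension.\<close>

lemma length_singular_values: "length (singular_values (T :: real^'d^'d)) = CARD('d)"
proof -
  have "charpoly (transpose T ** T) \<noteq> 0"
    using degree_charpoly[of "transpose T ** T"] by auto
  then have "size (proots (charpoly (transpose T ** T))) = CARD('d)"
    using charpoly_gram_root_real by (subst size_proots_real_rooted) (auto simp: degree_charpoly)
  moreover have "length (sorted_list_of_multiset M) = size M" for M :: "real multiset"
    by (metis mset_sorted_list_of_multiset size_mset)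
  ultimately show ?thesis
    by (simp add: singular_values_def)
qed

lemma set_singular_values:
  fixes T :: "real^'d^'d"
  shows "set (singular_values T) = sqrt ` {x. \<exists>v. v \<noteq> 0 \<and> (transpose T ** T) *v v = x *\<^sub>R v}"
proof -
  have "charpoly (transpose T ** T) \<noteq> 0"
    using degree_charpoly[of "transpose T ** T"] by auto
  then show ?thesis
    by (simp add: singular_values_def charpoly_gram_root_iff)
qed

lemma sing_val_antimono:
  fixes T :: "real^'d^'d"
  assumes "1 \<le> i" "i \<le> j" "j \<le> CARD('d)"
  shows "sing_val j T \<le> sing_val i T"
proof -
  have "sorted_wrt (\<ge>) (singular_values T)"
    by (simp add: singular_values_def sorted_wrt_rev)
  then have "singular_values T ! l \<le> singular_values T ! k" if "k < l" "l < CARD('d)" for k l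
    using that length_singular_values[of T] by (auto simp: sorted_wrt_iff_nth_less)
  then show ?thesis
    using assms by (cases "i = j") (auto simp: sing_val_def)
qed

lemma sing_val_in_set:
  fixes T :: "real^'d^'d"
  assumes "1 \<le> i" "i \<le> CARD('d)"
  shows "sing_val i T \<in> set (singular_values T)"
  using assms length_singular_values[of T] unfolding sing_val_def by (intro nth_mem) auto

lemma in_set_singular_values:
  fixes T :: "real^'d^'d"
  assumes "a \<in> set (singular_values T)"
  obtains i where "1 \<le> i" "i \<le> CARD('d)" "a = sing_val i T"
proof -
  obtain k where "k < CARD('d)" "a = singular_values T ! k"
    using assms length_singular_values[of T] by (auto simp: in_set_conv_nth)
  then show ?thesis
    using that[of "Suc k"] by (simp add: sing_val_def)
qed

text \<open>An eigenvector \<open>v\<close> of the Gram matrix realises the singular value as the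
  ratio |T v| / |v|. Norm bounds thus pass to every singular value without a minimax
  principle.\<close>

lemma sing_val_bounds:
  fixes T :: "real^'d^'d"
  assumes lower: "\<And>x. a * norm x \<le> norm (T *v x)" and upper: "\<And>x. norm (T *v x) \<le> b * norm x"
    and i: "1 \<le> i" "i \<le> CARD('d)"
  shows "a \<le> sing_val i T \<and> sing_val i T \<le> b"
proof -
  obtain x v where v: "v \<noteq> 0" "(transpose T ** T) *v v = x *\<^sub>R v" and x: "sing_val i T = sqrt x"
    using sing_val_in_set[OF i, of T] by (auto simp: set_singular_values)
  have "x * (norm v)\<^sup>2 = v \<bullet> ((transpose T ** T) *v v)"
    unfolding v by (simp add: power2_norm_eq_inner)
  also have "\<dots> = (norm (T *v v))\<^sup>2"
    unfolding transpose_mult_self_inner by (simp add: power2_norm_eq_inner)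
  finally have "sqrt x * norm v = norm (T *v v)"
    by (metis abs_norm_cancel real_sqrt_abs real_sqrt_mult)
  then show ?thesis
    using lower[of v] upper[of v] v(1) unfolding x
    by (metis mult_le_cancel_right_pos zero_less_norm_iff)
qed

text \<open>The extreme ratios |T x| / |x| are themselves singular values, since their extremisers
  are eigenvectors of the Gram matrix. They therefore lie between the last and the first entry of
  the ordered list.\<close>

lemma sing_val_norm_bounds:
  fixes T :: "real^'d^'d"
  shows "norm (T *v x) \<le> sing_val 1 T * norm x"
    and "sing_val CARD('d) T * norm x \<le> norm (T *v x)"
proof -
  let ?A = "transpose T ** T"
  obtain v w where nrm: "norm v = 1" "norm w = 1"
    and v: "\<And>x. norm (T *v x) \<le> norm (T *v v) * norm x"
    and w: "\<And>x. norm (T *v w) * norm x \<le> norm (T *v x)"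
    by (rule norm_ratio_attains[of T]) blast
  have form: "x \<bullet> (?A *v x) = (norm (T *v x))\<^sup>2" for x
    by (simp add: transpose_mult_self_inner power2_norm_eq_inner)
  have sym: "x \<bullet> (?A *v y) = (?A *v x) \<bullet> y" for x y
    by (metis inner_commute transpose_mult_self_inner)
  have "?A *v v = (norm (T *v v))\<^sup>2 *\<^sub>R v"
  proof (rule extremal_quadratic_form_eigenvector)
    show "v \<bullet> (?A *v v) = (norm (T *v v))\<^sup>2 * (v \<bullet> v)"
      using nrm by (simp add: form flip: power2_norm_eq_inner)
    show "(\<forall>x. x \<bullet> (?A *v x) \<le> (norm (T *v v))\<^sup>2 * (x \<bullet> x))
        \<or> (\<forall>x. (norm (T *v v))\<^sup>2 * (x \<bullet> x) \<le> x \<bullet> (?A *v x))"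
      using power_mono[OF v norm_ge_zero, where n = 2]
      by (simp add: form power_mult_distrib flip: power2_norm_eq_inner)
  qed (use sym in auto)
  then have "norm (T *v v) \<in> set (singular_values T)"
    unfolding set_singular_values using nrm
    by (intro image_eqI[of _ _ "(norm (T *v v))\<^sup>2"] CollectI exI[of _ v]) auto
  then have "norm (T *v v) \<le> sing_val 1 T"
    by (elim in_set_singular_values) (simp add: sing_val_antimono)
  then show "norm (T *v x) \<le> sing_val 1 T * norm x"
    by (meson v mult_right_mono norm_ge_zero order_trans)
  have "?A *v w = (norm (T *v w))\<^sup>2 *\<^sub>R w"
  proof (rule extremal_quadratic_form_eigenvector)
    show "w \<bullet> (?A *v w) = (norm (T *v w))\<^sup>2 * (w \<bullet> w)"
      using nrm by (simp add: form flip: power2_norm_eq_inner)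
    show "(\<forall>x. x \<bullet> (?A *v x) \<le> (norm (T *v w))\<^sup>2 * (x \<bullet> x))
        \<or> (\<forall>x. (norm (T *v w))\<^sup>2 * (x \<bullet> x) \<le> x \<bullet> (?A *v x))"
      using power_mono[OF w, where n = 2]
      by (simp add: form power_mult_distrib flip: power2_norm_eq_inner)
  qed (use sym in auto)
  then have "norm (T *v w) \<in> set (singular_values T)"
    unfolding set_singular_values using nrm
    by (intro image_eqI[of _ _ "(norm (T *v w))\<^sup>2"] CollectI exI[of _ w]) auto
  then have "sing_val CARD('d) T \<le> norm (T *v w)"
    by (elim in_set_singular_values) (simp add: sing_val_antimono)
  then show "sing_val CARD('d) T * norm x \<le> norm (T *v x)"
    by (meson w mult_right_mono norm_ge_zero order_trans)
qed

section \<open>The singular value function\<close>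

text \<open>The exponents of the singular values in the singular value function add up to \<open>s\<close> and
  increase with \<open>s\<close>, which makes the comparison of two parameters uniform across the cases
  of the definition.\<close>

definition svf_exponent :: "real \<Rightarrow> nat \<Rightarrow> nat \<Rightarrow> real" where
  "svf_exponent s d i = (if s \<le> real d then max 0 (min 1 (s - real i + 1)) else s / real d)"

lemma ceiling_split:
  assumes "0 < s" "s \<le> real d"
  defines "m \<equiv> nat \<lceil>s\<rceil>"
  shows "{1..d} = {1..<m} \<union> insert m {m<..d}" "1 \<le> m"
    and "\<And>i. i \<in> {1..<m} \<Longrightarrow> svf_exponent s d i = 1"
    and "svf_exponent s d m = s - real m + 1"
    and "\<And>i. i \<in> {m<..d} \<Longrightarrow> svf_exponent s d i = 0"
proof -
  have m: "real m - 1 < s" "s \<le> real m" "1 \<le> m" "m \<le> d"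
    using assms unfolding m_def by linarith+
  show "{1..d} = {1..<m} \<union> insert m {m<..d}" "1 \<le> m"
    using m by auto
  show "svf_exponent s d i = 1" if "i \<in> {1..<m}" for i
  proof -
    have "real i + 1 \<le> real m"
      using that by auto
    then show ?thesis
      using assms(2) m by (simp add: svf_exponent_def)
  qed
  show "svf_exponent s d m = s - real m + 1"
    using assms(2) m by (simp add: svf_exponent_def)
  show "svf_exponent s d i = 0" if "i \<in> {m<..d}" for i
  proof -
    have "real m + 1 \<le> real i"
      using that by auto
    then show ?thesis
      using assms(2) m by (simp add: svf_exponent_def)
  qed
qed

lemma svf_exponent_mono:
  assumes "0 < s" "s \<le> t" "0 < d"
  shows "svf_exponent s d i \<le> svf_exponent t d i"
proof (cases "s \<le> real d \<and> real d < t")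
  \<comment> \<open>Here the two formulas for the exponent meet, and the value 1 separates
    them.\<close>
  case True
  then have "svf_exponent s d i \<le> 1" "1 \<le> svf_exponent t d i"
    using assms by (auto simp: svf_exponent_def)
  then show ?thesis
    by linarith
next
  case False
  then show ?thesis
    using assms by (auto simp: svf_exponent_def divide_right_mono)
qed

lemma sum_svf_exponent:
  assumes "0 < s" "0 < d"
  shows "(\<Sum>i=1..d. svf_exponent s d i) = s"
proof (cases "s \<le> real d")
  case True
  define m where "m = nat \<lceil>s\<rceil>"
  note split = ceiling_split[OF assms(1) True, folded m_def]
  show ?thesis
    unfolding split(1) by (subst sum.union_disjoint) (use split in auto)
next
  case False
  then show ?thesis
    using assms by (simp add: svf_exponent_def)
qed

lemma svf_eq_prod_powr:
  fixes T :: "real^'d^'d"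
  assumes "0 < s" and pos: "\<And>i. 1 \<le> i \<Longrightarrow> i \<le> CARD('d) \<Longrightarrow> 0 < sing_val i T"
  shows "svf s T = (\<Prod>i=1..CARD('d). sing_val i T powr svf_exponent s CARD('d) i)"
proof (cases "s \<le> real CARD('d)")
  case True
  define m where "m = nat \<lceil>s\<rceil>"
  note split = ceiling_split[OF assms(1) True, folded m_def]
  have le: "m \<le> CARD('d)"
    using split(1,2) by auto
  have "(\<Prod>i=1..CARD('d). sing_val i T powr svf_exponent s CARD('d) i)
      = (\<Prod>i\<in>{1..<m}. sing_val i T powr svf_exponent s CARD('d) i)
        * (sing_val m T powr svf_exponent s CARD('d) m
        * (\<Prod>i\<in>{m<..CARD('d)}. sing_val i T powr svf_exponent s CARD('d) i))"
    unfolding split(1) by (subst prod.union_disjoint) auto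
  also have "(\<Prod>i\<in>{1..<m}. sing_val i T powr svf_exponent s CARD('d) i) = (\<Prod>i=1..<m. sing_val i T)"
    using le by (intro prod.cong refl) (simp add: split pos less_imp_le)
  \<comment> \<open>Positivity matters: \<open>0 powr 0\<close> is 0, so the exponent 0 gives the
    factor 1 only for a nonzero base.\<close>
  also have "(\<Prod>i\<in>{m<..CARD('d)}. sing_val i T powr svf_exponent s CARD('d) i) = 1"
    using pos by (intro prod.neutral ballI) (simp add: split less_imp_neq[symmetric])
  finally show ?thesis
    using assms(1) True by (simp add: svf_def Let_def split flip: m_def)
next
  case False
  then show ?thesis
    using assms(1) pos
    by (simp add: svf_def svf_exponent_def less_imp_le flip: prod_powr_distrib)
qed

text \<open>Raising the parameter raises each exponent, and each extra power is bounded by the same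
  power of \<open>b\<close>. The extra exponents add up to \<open>t - s\<close>.\<close>

lemma svf_le_powr:
  fixes T :: "real^'d^'d"
  assumes "0 < s" "s \<le> t"
    and pos: "\<And>i. 1 \<le> i \<Longrightarrow> i \<le> CARD('d) \<Longrightarrow> 0 < sing_val i T"
    and le: "\<And>i. 1 \<le> i \<Longrightarrow> i \<le> CARD('d) \<Longrightarrow> sing_val i T \<le> b"
  shows "svf t T \<le> svf s T * b powr (t - s)"
proof -
  let ?e = "\<lambda>s. svf_exponent s CARD('d)"
  have b: "0 < b"
    using pos[of 1] le[of 1] by simp
  have "svf t T = (\<Prod>i=1..CARD('d). sing_val i T powr ?e t i)"
    using assms by (simp add: svf_eq_prod_powr)
  also have "\<dots> = (\<Prod>i=1..CARD('d). sing_val i T powr ?e s i * sing_val i T powr (?e t i - ?e s i))"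
    by (simp flip: powr_add)
  also have "\<dots> \<le> (\<Prod>i=1..CARD('d). sing_val i T powr ?e s i * b powr (?e t i - ?e s i))"
    using assms svf_exponent_mono[of s t "CARD('d)"]
    by (intro prod_mono conjI mult_left_mono powr_mono2) (auto simp: less_imp_le)
  also have "\<dots> = svf s T * b powr (\<Sum>i=1..CARD('d). ?e t i - ?e s i)"
    using assms b by (simp add: prod.distrib svf_eq_prod_powr powr_sum)
  also have "(\<Sum>i=1..CARD('d). ?e t i - ?e s i) = t - s"
    using assms unfolding sum_subtractf by (subst (1 2) sum_svf_exponent) auto
  finally show ?thesis .
qed

lemma svf_nonneg:
  fixes T :: "real^'d^'d"
  assumes "0 < s" and "\<And>i. 1 \<le> i \<Longrightarrow> i \<le> CARD('d) \<Longrightarrow> 0 < sing_val i T"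
  shows "0 \<le> svf s T"
  using assms by (simp add: svf_eq_prod_powr prod_nonneg)

section \<open>Products along words and stopping words\<close>

lemma foldr_matrix_mult_bounds:
  fixes Ms :: "(real^'d^'d) list"
  assumes "\<And>M x. M \<in> set Ms \<Longrightarrow> a * norm x \<le> norm (M *v x) \<and> norm (M *v x) \<le> b * norm x"
    and "0 \<le> a" "0 \<le> b"
  shows "a ^ length Ms * norm x \<le> norm (foldr (**) Ms (mat 1) *v x)
    \<and> norm (foldr (**) Ms (mat 1) *v x) \<le> b ^ length Ms * norm x"
  using assms(1)
proof (induction Ms)
  case Nil
  then show ?case
    by simp
next
  case (Cons M Ms)
  let ?y = "foldr (**) Ms (mat 1) *v x"
  have M: "a * norm ?y \<le> norm (M *v ?y)" "norm (M *v ?y) \<le> b * norm ?y"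
    using Cons.prems by auto
  have "a ^ length Ms * norm x \<le> norm ?y" "norm ?y \<le> b ^ length Ms * norm x"
    using Cons.IH Cons.prems by auto
  then have "a * (a ^ length Ms * norm x) \<le> a * norm ?y" "b * norm ?y \<le> b * (b ^ length Ms * norm x)"
    using assms(2,3) by (auto intro: mult_left_mono)
  with M show ?case
    by (simp add: mult.assoc flip: matrix_vector_mul_assoc)
qed

text \<open>The bounds are stated for norms because these multiply along products of matrices, while
  individual singular values do not.\<close>

locale contracting_matrices =
  fixes n :: "nat \<Rightarrow> nat" and T :: "nat \<Rightarrow> nat \<Rightarrow> real^'d^'d" and a b :: real
  assumes a_pos: "0 < a" and a_le_b: "a \<le> b" and b_less_1: "b < 1"
    and norm_bounds: "\<And>k i x. 1 \<le> k \<Longrightarrow> i \<in> {1..n k} \<Longrightarrow>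
      a * norm x \<le> norm (T k i *v x) \<and> norm (T k i *v x) \<le> b * norm x"
begin

lemma sing_val_word_bounds:
  assumes "u \<in> words n" "1 \<le> i" "i \<le> CARD('d)"
  shows "a ^ length u \<le> sing_val i (word_mat T u)" "sing_val i (word_mat T u) \<le> b ^ length u"
proof -
  let ?Ms = "map (\<lambda>j. T (Suc j) (u ! j)) [0..<length u]"
  have "a * norm x \<le> norm (M *v x) \<and> norm (M *v x) \<le> b * norm x" if "M \<in> set ?Ms" for M x
    using that assms(1) norm_bounds by (auto simp: words_def)
  then have "a ^ length u * norm x \<le> norm (word_mat T u *v x)
      \<and> norm (word_mat T u *v x) \<le> b ^ length u * norm x" for x
    using foldr_matrix_mult_bounds[of ?Ms a b x] a_pos a_le_b by (simp add: word_mat_def)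
  then show "a ^ length u \<le> sing_val i (word_mat T u)" "sing_val i (word_mat T u) \<le> b ^ length u"
    using sing_val_bounds[of "a ^ length u" "word_mat T u" "b ^ length u" i] assms by auto
qed

lemma sing_val_word_pos:
  assumes "u \<in> words n" "1 \<le> i" "i \<le> CARD('d)"
  shows "0 < sing_val i (word_mat T u)"
  using sing_val_word_bounds(1)[OF assms] a_pos by (meson less_le_trans zero_less_power)

text \<open>Along the prefixes of an infinite word the relevant singular value starts above
  \<epsilon> and is eventually below it, being at most \<open>b ^ k\<close>. The prefix at the first
  crossing is a stopping word.\<close>

lemma infinite_words_subset_stopping_cylinders:
  assumes "0 < s" "0 < \<epsilon>" "\<epsilon> < 1"
  shows "infinite_words n \<subseteq> (\<Union>u\<in>stopping_words n T s \<epsilon>. cylinder n u)"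
proof
  fix w assume w: "w \<in> infinite_words n"
  define m where "m = min (nat \<lceil>s\<rceil>) CARD('d)"
  have m: "1 \<le> m" "m \<le> CARD('d)"
    using assms(1) unfolding m_def by (auto simp: Suc_le_eq)
  define pre where "pre k = map w [0..<k]" for k
  have pre: "pre k \<in> words n" "length (pre k) = k" for k
    using w by (auto simp: pre_def words_def infinite_words_def)
  define P where "P k \<longleftrightarrow> sing_val m (word_mat T (pre k)) \<le> \<epsilon>" for k
  obtain k0 where "b ^ k0 < \<epsilon>"
    using real_arch_pow_inv[OF assms(2) b_less_1] by blast
  then have "P k0"
    using sing_val_word_bounds(2)[OF pre(1) m, of k0] by (simp add: P_def pre)
  then obtain k where k: "P k" "\<And>j. j < k \<Longrightarrow> \<not> P j"
    by (meson LeastI_ex not_less_Least)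
  \<comment> \<open>The empty prefix gives the identity, whose singular values are at least
    \<open>a ^ 0 = 1\<close>. Hence the crossing prefix is nonempty and its \<open>butlast\<close>
    is the preceding prefix.\<close>
  have "\<not> P 0"
    using sing_val_word_bounds(1)[OF pre(1) m, of 0] assms(3) by (simp add: P_def pre)
  with k(1) obtain j where j: "k = Suc j"
    by (cases k) auto
  have "butlast (pre k) = pre j"
    by (simp add: pre_def j)
  then have "pre k \<in> stopping_words n T s \<epsilon>"
    using k(1) k(2)[of j] pre[of k] j
    unfolding stopping_words_def Let_def m_def[symmetric] P_def by auto
  moreover have "w \<in> cylinder n (pre k)"
    using w by (auto simp: cylinder_def pre_def)
  ultimately show "w \<in> (\<Union>u\<in>stopping_words n T s \<epsilon>. cylinder n u)"
    by blast
qed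

text \<open>A word shorter than \<open>K\<close> has all its singular values at least
  \<open>a ^ K\<close>, which exceeds \<epsilon>.\<close>

lemma length_stopping_words:
  assumes "0 < s" "u \<in> stopping_words n T s \<epsilon>" "\<epsilon> < a ^ K"
  shows "K \<le> length u"
proof (rule ccontr)
  assume "\<not> K \<le> length u"
  then have "a ^ K \<le> a ^ length u"
    using a_pos a_le_b b_less_1 by (intro power_decreasing) auto
  also have "\<dots> \<le> sing_val (min (nat \<lceil>s\<rceil>) CARD('d)) (word_mat T u)"
    using assms(1,2)
    by (intro sing_val_word_bounds) (auto simp: stopping_words_def Let_def Suc_le_eq)
  also have "\<dots> \<le> \<epsilon>"
    using assms(2) by (simp add: stopping_words_def Let_def)
  finally show False
    using assms(3) by simp
qed

lemma svf_word_le: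
  assumes "0 < s" "s \<le> t" "u \<in> words n" "K \<le> length u"
  shows "svf t (word_mat T u) \<le> svf s (word_mat T u) * (b powr (t - s)) ^ K"
proof -
  have b: "0 < b"
    using a_pos a_le_b by simp
  have "svf t (word_mat T u) \<le> svf s (word_mat T u) * (b ^ length u) powr (t - s)"
    using assms sing_val_word_pos sing_val_word_bounds by (intro svf_le_powr) auto
  also have "\<dots> \<le> svf s (word_mat T u) * (b ^ K) powr (t - s)"
    using assms b b_less_1 sing_val_word_pos
    by (intro mult_left_mono powr_mono2 power_decreasing svf_nonneg) auto
  also have "(b ^ K) powr (t - s) = (b powr real K) powr (t - s)"
    using b by (simp only: powr_realpow)
  also have "\<dots> = (b powr (t - s)) ^ K"
    using b by (simp add: powr_powr powr_power mult.commute)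
  finally show ?thesis .
qed

section \<open>Vanishing of the net measure above a finite upper limit\<close>

lemma net_measure_at_le:
  assumes "0 < s" "s \<le> t" "0 < \<epsilon>" "\<epsilon> < 1" "\<epsilon> < a ^ K" "k \<le> K"
  shows "net_measure_at n T t k (infinite_words n)
    \<le> (\<Sum>\<^sub>\<infinity>u\<in>stopping_words n T s \<epsilon>. ennreal (svf s (word_mat T u))) * ennreal ((b powr (t - s)) ^ K)"
proof -
  let ?U = "stopping_words n T s \<epsilon>" and ?q = "(b powr (t - s)) ^ K"
  have U: "u \<in> words n" "K \<le> length u" if "u \<in> ?U" for u
    using that length_stopping_words[OF assms(1) that assms(5)]
    by (auto simp: stopping_words_def Let_def)
  have "net_measure_at n T t k (infinite_words n) \<le> (\<Sum>\<^sub>\<infinity>u\<in>?U. ennreal (svf t (word_mat T u)))"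
    unfolding net_measure_at_def
    using U infinite_words_subset_stopping_cylinders[OF assms(1,3,4)] assms(6)
    by (intro INF_lower) (auto intro: order_trans[OF assms(6)])
  also have "\<dots> \<le> (\<Sum>\<^sub>\<infinity>u\<in>?U. ennreal (svf s (word_mat T u))) * ennreal ?q"
    \<comment> \<open>Infinite sums of nonnegative extended reals are suprema of finite partial
      sums, so it is enough to compare the latter.\<close>
    unfolding nonneg_infsum_complete[OF zero_le]
  proof (rule SUP_least)
    fix F assume F: "F \<in> {F. finite F \<and> F \<subseteq> ?U}"
    have "(\<Sum>u\<in>F. ennreal (svf t (word_mat T u))) \<le> (\<Sum>u\<in>F. ennreal (svf s (word_mat T u)) * ennreal ?q)"
      using F U svf_word_le[OF assms(1,2)]
      by (intro sum_mono) (auto intro!: ennreal_leI simp flip: ennreal_mult'')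
    also have "\<dots> = (\<Sum>u\<in>F. ennreal (svf s (word_mat T u))) * ennreal ?q"
      by (simp add: sum_distrib_right)
    also have "\<dots> \<le> (SUP F\<in>{F. finite F \<and> F \<subseteq> ?U}. \<Sum>u\<in>F. ennreal (svf s (word_mat T u))) * ennreal ?q"
      using F by (intro mult_right_mono SUP_upper) auto
    finally show "(\<Sum>u\<in>F. ennreal (svf t (word_mat T u)))
      \<le> (SUP F\<in>{F. finite F \<and> F \<subseteq> ?U}. \<Sum>u\<in>F. ennreal (svf s (word_mat T u))) * ennreal ?q" .
  qed
  finally show ?thesis .
qed

text \<open>With \<open>k\<close> fixed, the stopping words may be taken of length at least any
  \<open>K\<close> beyond \<open>k\<close>. Letting \<open>K\<close> grow gives 0 already at level
  \<open>k\<close>, before the limit in \<open>k\<close>.\<close>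

lemma net_measure_eq_0:
  assumes "0 < s" "s < t"
    and fin: "Limsup (at_right 0)
      (\<lambda>\<epsilon>. \<Sum>\<^sub>\<infinity>u\<in>stopping_words n T s \<epsilon>. ennreal (svf s (word_mat T u))) < \<infinity>"
  shows "net_measure n T t (infinite_words n) = 0"
proof -
  \<comment> \<open>A strict bound \<open>C\<close> above the upper limit holds for all small
    \<epsilon>. Its finiteness lets \<open>C * ennreal (q ^ K)\<close> tend to 0.\<close>
  obtain C where C: "Limsup (at_right 0)
      (\<lambda>\<epsilon>. \<Sum>\<^sub>\<infinity>u\<in>stopping_words n T s \<epsilon>. ennreal (svf s (word_mat T u))) < C" "C < \<infinity>"
    using dense[OF fin] by auto
  define q where "q = b powr (t - s)"
  have q: "0 \<le> q" "q < 1"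
    using assms(2) a_pos a_le_b b_less_1 by (auto simp: q_def powr01_less_one)
  have "net_measure_at n T t k (infinite_words n) = 0" for k
  proof -
    have bound: "net_measure_at n T t k (infinite_words n) \<le> C * ennreal (q ^ K)" if "k \<le> K" for K
    proof -
      have "eventually (\<lambda>\<epsilon>. (\<Sum>\<^sub>\<infinity>u\<in>stopping_words n T s \<epsilon>. ennreal (svf s (word_mat T u))) < C) (at_right 0)"
        by (rule Limsup_lessD[OF C(1)])
      moreover have "eventually (\<lambda>\<epsilon>. \<epsilon> \<in> {0<..<min 1 (a ^ K)}) (at_right 0)"
        using a_pos by (intro eventually_at_right_real) auto
      ultimately have "eventually (\<lambda>\<epsilon>. (\<Sum>\<^sub>\<infinity>u\<in>stopping_words n T s \<epsilon>. ennreal (svf s (word_mat T u))) < C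
          \<and> \<epsilon> \<in> {0<..<min 1 (a ^ K)}) (at_right 0)"
        by (rule eventually_conj)
      then obtain \<epsilon> where \<epsilon>: "(\<Sum>\<^sub>\<infinity>u\<in>stopping_words n T s \<epsilon>. ennreal (svf s (word_mat T u))) < C"
          "\<epsilon> \<in> {0<..<min 1 (a ^ K)}"
        using eventually_happens'[OF trivial_limit_at_right_real[of "0::real"]] by blast
      then have "net_measure_at n T t k (infinite_words n)
          \<le> (\<Sum>\<^sub>\<infinity>u\<in>stopping_words n T s \<epsilon>. ennreal (svf s (word_mat T u))) * ennreal (q ^ K)"
        unfolding q_def using assms that by (intro net_measure_at_le) auto
      also have "\<dots> \<le> C * ennreal (q ^ K)"
        using \<epsilon>(1) by (intro mult_right_mono) auto
      finally show ?thesis .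
    qed
    have "(\<lambda>K. ennreal (q ^ K)) \<longlonglongrightarrow> ennreal 0"
      using q by (intro tendsto_ennrealI LIMSEQ_realpow_zero) auto
    then have "(\<lambda>K. C * ennreal (q ^ K)) \<longlonglongrightarrow> C * ennreal 0"
      using C(2) by (intro ennreal_tendsto_cmult) auto
    then have "net_measure_at n T t k (infinite_words n) \<le> C * ennreal 0"
      using bound by (intro LIMSEQ_le_const) auto
    then show ?thesis
      by simp
  qed
  then show ?thesis
    by (simp add: net_measure_def)
qed

text \<open>The vanishing result requires an exponent strictly above \<open>s\<close>, whence the
  slack \<open>e\<close>. Bounding each candidate \<open>s\<close> also covers an empty candidate
  set, where \<open>s_star\<close> is infinite.\<close>

lemma s_A_le_s_star: "s_A n T \<le> s_star n T"
  unfolding s_star_def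
proof (rule Inf_greatest)
  fix x
  assume "x \<in> ereal ` {s. 0 < s \<and> Limsup (at_right 0)
    (\<lambda>\<epsilon>. \<Sum>\<^sub>\<infinity>u\<in>stopping_words n T s \<epsilon>. ennreal (svf s (word_mat T u))) < \<infinity>}"
  then obtain s where x: "x = ereal s" and s: "0 < s" "Limsup (at_right 0)
    (\<lambda>\<epsilon>. \<Sum>\<^sub>\<infinity>u\<in>stopping_words n T s \<epsilon>. ennreal (svf s (word_mat T u))) < \<infinity>"
    by auto
  have "s_A n T \<le> ereal s + ereal e" if "0 < e" for e
  proof -
    have "net_measure n T (s + e) (infinite_words n) = 0"
      using s that by (intro net_measure_eq_0) auto
    then show ?thesis
      unfolding s_A_def using s that by (intro Inf_lower) auto
  qed
  then show "s_A n T \<le> x"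
    unfolding x by (rule ereal_le_epsilon2)
qed

end

theorem proposition7p1:
  fixes n :: "nat \<Rightarrow> nat" and T :: "nat \<Rightarrow> nat \<Rightarrow> real^'d^'d"
  assumes "\<And>k. 1 \<le> k \<Longrightarrow> 2 \<le> n k"
    and "\<And>k i. 1 \<le> k \<Longrightarrow> 1 \<le> i \<Longrightarrow> i \<le> n k \<Longrightarrow> invertible (T k i)"
    and "0 < alpha_minus n T" and "alpha_minus n T \<le> alpha_plus n T" and "alpha_plus n T < 1"
  shows "s_A n T \<le> s_star n T"
proof -
  \<comment> \<open>The standing assumption places both extended reals strictly between 0 and 1, so
    they are real numbers.\<close>
  obtain a where a: "alpha_minus n T = ereal a"
    using assms(3-5) by (cases "alpha_minus n T") auto
  obtain b where b: "alpha_plus n T = ereal b"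
    using assms(3-5) by (cases "alpha_plus n T") auto
  have lower: "a \<le> sing_val CARD('d) (T k i)" if "1 \<le> k" "i \<in> {1..n k}" for k i
  proof -
    have "alpha_minus n T \<le> ereal (sing_val CARD('d) (T k i))"
      unfolding alpha_minus_def by (rule INF_lower2[of "(k, i)"]) (use that in auto)
    then show ?thesis
      by (simp add: a)
  qed
  have upper: "sing_val 1 (T k i) \<le> b" if "1 \<le> k" "i \<in> {1..n k}" for k i
  proof -
    have "ereal (sing_val 1 (T k i)) \<le> alpha_plus n T"
      unfolding alpha_plus_def by (rule SUP_upper2[of "(k, i)"]) (use that in auto)
    then show ?thesis
      by (simp add: b)
  qed
  have "a * norm x \<le> norm (T k i *v x) \<and> norm (T k i *v x) \<le> b * norm x"
    if "1 \<le> k" "i \<in> {1..n k}" for k i x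
    using sing_val_norm_bounds[of "T k i" x] lower[OF that] upper[OF that]
    by (meson mult_right_mono norm_ge_zero order_trans)
  then interpret contracting_matrices n T a b
    using assms(3-5) by unfold_locales (auto simp: a b)
  show ?thesis
    by (rule s_A_le_s_star)
qed

end
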